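(* For any $S\in GL_2(\mathbb{Z})$, it holds that $h(G^{S})>0$ if and only if $S\neq S^{\top}$ and $\operatorname{tr}(S)\neq 0$.
   Context: $S^{\top}$ is the transpose of $S$ and $\operatorname{tr}(S)$ its trace. $G^S$ is the infinite undirected graph with vertex set $\mathbb{Z}^2\setminus\{0\}$ and edge set $\{\{z,Sz\},\{z,S^{\top}z\}: z\in\mathbb{Z}^2\setminus\{0\}\}$. For an infinite graph $G=(V,E)$, the Cheeger constant is $h(G)=\inf\{|E(U)|/|U| : U\subseteq V \text{ finite, nonempty}\}$, where $E(U)$ is the set of edges with exactly one endpoint in $U$. *)

theory Defs
  imports "HOL-Analysis.Analysis"
begin

text \<open>
  An undirected graph is given by a vertex set and a set of edges, an edge being the set of its
  one or two endpoints. A loop is thus a singleton; both of its ends are the same vertex, so it never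
  joins a set of vertices to its complement and never belongs to an edge boundary.
\<close>

definition edge_boundary :: "'v set set \<Rightarrow> 'v set \<Rightarrow> 'v set set" where
  "edge_boundary E U = {e \<in> E. \<exists>u v. e = {u, v} \<and> u \<in> U \<and> v \<notin> U}"

text \<open>
  The real-valued ratio below is the intended one for locally finite graphs with nonempty vertex set
  (an infinite boundary would have \<^term>\<open>card\<close> equal to 0). The lemma
  \<open>finite_edge_boundary_GS_edges\<close> below shows that this covers the graphs considered here.
\<close>

definition cheeger_constant :: "'v set \<Rightarrow> 'v set set \<Rightarrow> real" where
  "cheeger_constant V E =
     (INF U \<in> {U. U \<subseteq> V \<and> finite U \<and> U \<noteq> {}}. real (card (edge_boundary E U)) / real (card U))"

definition GS_vertices :: "(int ^ 2) set" where
  "GS_vertices = UNIV - {0}"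

definition GS_edges :: "int ^ 2 ^ 2 \<Rightarrow> (int ^ 2) set set" where
  "GS_edges S = (\<Union>z\<in>GS_vertices. {{z, S *v z}, {z, transpose S *v z}})"

lemma inj_matrix_vector_mult_int:
  fixes A :: "int ^ 2 ^ 2"
  assumes "invertible A"
  shows "inj ((*v) A)"
proof -
  obtain B where "B ** A = mat 1"
    using assms by (auto simp: invertible_def)
  then have "B *v (A *v x) = x" for x
    by (simp add: matrix_vector_mul_assoc)
  then show ?thesis
    by (metis injI)
qed

lemma finite_edge_boundary_GS_edges:
  assumes "invertible S" and "finite U"
  shows "finite (edge_boundary (GS_edges S) U)"
proof -
  obtain B where "S ** B = mat 1" "B ** S = mat 1"
    using assms(1) by (auto simp: invertible_def)
  then have "transpose S ** transpose B = mat 1" "transpose B ** transpose S = mat 1"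
    by (metis matrix_transpose_mul transpose_mat)+
  then have "invertible (transpose S)"
    by (auto simp: invertible_def)
  then have inj: "inj ((*v) S)" "inj ((*v) (transpose S))"
    using assms(1) inj_matrix_vector_mult_int by blast+
  let ?Z = "U \<union> (*v) S -` U \<union> (*v) (transpose S) -` U"
  have "edge_boundary (GS_edges S) U
      \<subseteq> (\<lambda>z. {z, S *v z}) ` ?Z \<union> (\<lambda>z. {z, transpose S *v z}) ` ?Z"
    unfolding edge_boundary_def GS_edges_def by (auto simp: doubleton_eq_iff)
  moreover have "finite ?Z"
    using assms(2) inj by (simp add: finite_vimageI)
  ultimately show ?thesis
    by (meson finite_UnI finite_imageI finite_subset)
qed

end

theory Submission
  imports Defs
begin

text \<open>
  For a matrix \<open>A\<close> let \<open>R z = |A z|\<^sup>2 / |z|\<^sup>2\<close>. The symmetric matrix \<open>A\<^sup>T A\<close> pushes vectors towards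
  its dominant eigendirection, and by Cayley--Hamilton the function \<open>R\<close> increases along \<open>z \<mapsto> A\<^sup>T A z\<close>
  by \<open>tr (A\<^sup>T A) det (z, A\<^sup>T A z)\<^sup>2 / (|z|\<^sup>2 |A\<^sup>T A z|\<^sup>2)\<close>. This vanishes only at eigenvectors.
  If \<open>S\<close> is not symmetric and has nonzero trace, then \<open>S\<^sup>T S\<close> and \<open>S S\<^sup>T\<close> have no common eigenvector,
  so the gains for \<open>A = S\<close> and \<open>A = S\<^sup>T\<close> add up to at least some \<open>c > 0\<close> at every \<open>z\<close>. As the functions \<open>R\<close>
  are bounded, summing over a finite set \<open>U\<close> leaves only contributions of the points leaving \<open>U\<close>,
  which bounds \<open>c |U|\<close> by a multiple of the edge boundary.

  Conversely, if \<open>S\<close> is symmetric, or \<open>tr S = 0\<close> and hence \<open>S\<^sup>2 = \<plusminus>1\<close>, then balls grow linearly,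
  whereas a positive Cheeger constant forces exponential growth.
\<close>

text \<open>As a simp rule it would turn \<open>transpose A *v x\<close> into \<open>x v* A\<close>,
  away from the form used in \<open>GS_edges\<close>.\<close>

declare transpose_matrix_vector [simp del]

section \<open>Integer matrices of size two\<close>

lemma matrix_vector_mult_nth_2:
  fixes A :: "'a::comm_semiring_1 ^ 2 ^ 2"
  shows "(A *v z) $ 1 = A $ 1 $ 1 * z $ 1 + A $ 1 $ 2 * z $ 2"
    and "(A *v z) $ 2 = A $ 2 $ 1 * z $ 1 + A $ 2 $ 2 * z $ 2"
  by (simp_all add: matrix_vector_mult_def sum_2)

lemma vec_eq_iff_2: "(x :: 'a ^ 2) = y \<longleftrightarrow> x $ 1 = y $ 1 \<and> x $ 2 = y $ 2"
  by (simp add: vec_eq_iff forall_2)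

lemma invertible_transpose_int:
  fixes A :: "int ^ 2 ^ 2"
  assumes "invertible A"
  shows "invertible (transpose A)"
proof -
  obtain B where "A ** B = mat 1" "B ** A = mat 1"
    using assms by (auto simp: invertible_def)
  then have "transpose A ** transpose B = mat 1" "transpose B ** transpose A = mat 1"
    by (metis matrix_transpose_mul transpose_mat)+
  then show ?thesis
    by (auto simp: invertible_def)
qed

lemma matrix_vector_mult_eq_0_iff_int:
  fixes A :: "int ^ 2 ^ 2"
  assumes "invertible A"
  shows "A *v z = 0 \<longleftrightarrow> z = 0"
  using inj_eq[OF inj_matrix_vector_mult_int[OF assms], of z 0] by (simp add: matrix_vector_mult_0_right)

lemma det_invertible_int:
  fixes A :: "int ^ 2 ^ 2"
  assumes "invertible A"
  shows "det A = 1 \<or> det A = -1"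
proof -
  obtain B where "A ** B = mat 1"
    using assms by (auto simp: invertible_def)
  then have "det A * det B = 1"
    by (metis det_I det_mul)
  then show ?thesis
    by (simp add: zmult_eq_1_iff) blast
qed

section \<open>Cheeger constants and growth\<close>

lemma cheeger_constant_le:
  assumes "U \<subseteq> V" "finite U" "U \<noteq> {}"
  shows "cheeger_constant V E * card U \<le> card (edge_boundary E U)"
proof -
  have "cheeger_constant V E \<le> card (edge_boundary E U) / card U"
    unfolding cheeger_constant_def using assms
    by (intro cINF_lower) (auto intro!: bdd_belowI[where m = 0])
  with assms show ?thesis
    by (simp add: field_simps card_gt_0_iff)
qed

lemma cheeger_constant_ge:
  fixes c :: real
  assumes "V \<noteq> {}"
    and "\<And>U. U \<subseteq> V \<Longrightarrow> finite U \<Longrightarrow> U \<noteq> {} \<Longrightarrow> c * card U \<le> card (edge_boundary E U)"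
  shows "c \<le> cheeger_constant V E"
  unfolding cheeger_constant_def
proof (rule cINF_greatest)
  obtain v where "v \<in> V" using assms(1) by blast
  then have "{v} \<in> {U. U \<subseteq> V \<and> finite U \<and> U \<noteq> {}}" by simp
  then show "{U. U \<subseteq> V \<and> finite U \<and> U \<noteq> {}} \<noteq> {}" by blast
qed (use assms(2) in \<open>auto simp: field_simps card_gt_0_iff\<close>)

text \<open>If the constant were \<open>h > 0\<close>, each step from \<open>P n\<close> to
  \<open>P (Suc n)\<close> would multiply the size by at least \<open>1 + h / d\<close>.\<close>

lemma cheeger_constant_le_0_if_linear_growth:
  fixes P :: "nat \<Rightarrow> 'v set" and C d :: real
  assumes V: "\<And>n. P n \<subseteq> V" and fin: "\<And>n. finite (P n)" and ne: "P 0 \<noteq> {}"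
    and mono: "\<And>n. P n \<subseteq> P (Suc n)"
    and bd: "\<And>n. card (edge_boundary E (P n)) \<le> d * card (P (Suc n) - P n)"
    and growth: "\<And>n. card (P n) \<le> C * (real n + 1)"
    and "d > 0"
  shows "cheeger_constant V E \<le> 0"
proof (rule ccontr)
  assume "\<not> cheeger_constant V E \<le> 0"
  then have h: "cheeger_constant V E > 0" by simp
  define q where "q = 1 + cheeger_constant V E / d"
  have q: "q > 1" using h \<open>d > 0\<close> by (simp add: q_def)
  have ne': "P n \<noteq> {}" for n
    by (induction n) (use ne mono in blast)+
  have step: "q * card (P n) \<le> card (P (Suc n))" for n
  proof -
    have "cheeger_constant V E * card (P n) \<le> d * card (P (Suc n) - P n)"
      using cheeger_constant_le[OF V fin ne'] bd order_trans by blast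
    also have "real (card (P (Suc n) - P n)) = real (card (P (Suc n))) - real (card (P n))"
      using mono fin by (simp add: card_Diff_subset card_mono of_nat_diff)
    finally show ?thesis
      using \<open>d > 0\<close> by (simp add: q_def field_simps)
  qed
  have pow: "q ^ n \<le> card (P n)" for n
  proof (induction n)
    case 0
    then show ?case using fin[of 0] ne by (simp add: Suc_leI card_gt_0_iff)
  next
    case (Suc n)
    have "q ^ Suc n \<le> q * card (P n)" using Suc q by simp
    with step show ?case using order_trans by blast
  qed
  \<comment> \<open>Dividing both bounds on \<open>card (P n)\<close> by \<open>q ^ n\<close> gives
    \<open>1 \<le> C * (n + 1) * inverse q ^ n\<close>, and the right side tends to 0.\<close>
  have "norm (inverse q) < 1"
    using q by (simp add: field_simps)
  then have "(\<lambda>n. real n * inverse q ^ n) \<longlonglongrightarrow> 0" "(\<lambda>n. inverse q ^ n) \<longlonglongrightarrow> 0"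
    by (intro powser_times_n_limit_0 LIMSEQ_power_zero; simp)+
  then have "(\<lambda>n. C * (real n * inverse q ^ n + inverse q ^ n)) \<longlonglongrightarrow> C * (0 + 0)"
    by (intro tendsto_mult_left tendsto_add)
  moreover have "1 \<le> C * (real n * inverse q ^ n + inverse q ^ n)" for n
    using order_trans[OF pow growth, of n] q by (simp add: field_simps)
  ultimately have "1 \<le> C * (0 + 0)"
    by (intro LIMSEQ_le_const) blast+
  then show False by simp
qed

section \<open>Edge boundaries under injective maps\<close>

text \<open>An edge \<open>{z, f z}\<close> leaving \<open>U\<close> has its outer end in
  \<open>W - U\<close>. By injectivity each point there is the outer end of at most two such edges,
  once as \<open>z\<close> and once as \<open>f z\<close>.\<close>

lemma card_edges_leaving:
  assumes "inj f" and inU: "\<And>z. z \<in> U \<Longrightarrow> f z \<in> W" and outU: "\<And>z. f z \<in> U \<Longrightarrow> z \<in> W"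
    and "finite W"
  shows "finite ((\<lambda>z. {z, f z}) ` {z. (z \<in> U) \<noteq> (f z \<in> U)})" (is ?fin)
    and "card ((\<lambda>z. {z, f z}) ` {z. (z \<in> U) \<noteq> (f z \<in> U)}) \<le> 2 * card (W - U)" (is ?card)
proof -
  define D where "D = {z. (z \<in> U) \<noteq> (f z \<in> U)}"
  have D: "D \<subseteq> f -` (W - U) \<union> (W - U)"
    using inU outU by (auto simp: D_def)
  have fin: "finite (f -` (W - U))"
    using assms by (intro finite_vimageI) auto
  have finD: "finite D"
    using D fin \<open>finite W\<close> by (meson finite_Diff finite_UnI finite_subset)
  have "card D \<le> card (f -` (W - U) \<union> (W - U))"
    using D fin \<open>finite W\<close> by (intro card_mono) auto
  also have "\<dots> \<le> card (f -` (W - U)) + card (W - U)"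
    by (rule card_Un_le)
  also have "card (f -` (W - U)) = card (f ` (f -` (W - U)))"
    using \<open>inj f\<close> by (metis card_image inj_on_subset subset_UNIV)
  also have "\<dots> \<le> card (W - U)"
    using \<open>finite W\<close> by (intro card_mono) auto
  finally have "card D \<le> 2 * card (W - U)" by simp
  with card_image_le[OF finD, of "\<lambda>z. {z, f z}"] show ?card
    unfolding D_def by linarith
  from finD show ?fin unfolding D_def by simp
qed

lemma card_edge_boundary_GS_edges_le:
  assumes "invertible S" "finite W"
    and "\<And>z. z \<in> U \<Longrightarrow> S *v z \<in> W" "\<And>z. S *v z \<in> U \<Longrightarrow> z \<in> W"
    and "\<And>z. z \<in> U \<Longrightarrow> transpose S *v z \<in> W" "\<And>z. transpose S *v z \<in> U \<Longrightarrow> z \<in> W"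
  shows "card (edge_boundary (GS_edges S) U) \<le> 4 * card (W - U)"
proof -
  let ?B = "\<lambda>A. (\<lambda>z. {z, A *v z}) ` {z. (z \<in> U) \<noteq> (A *v z \<in> U)}"
  note S = card_edges_leaving[where f = "(*v) S" and U = U and W = W,
      OF inj_matrix_vector_mult_int[OF assms(1)] assms(3,4,2)]
  note T = card_edges_leaving[where f = "(*v) (transpose S)" and U = U and W = W,
      OF inj_matrix_vector_mult_int[OF invertible_transpose_int[OF assms(1)]] assms(5,6,2)]
  have "edge_boundary (GS_edges S) U \<subseteq> ?B S \<union> ?B (transpose S)"
    unfolding edge_boundary_def GS_edges_def by (auto simp: doubleton_eq_iff)
  then have "card (edge_boundary (GS_edges S) U) \<le> card (?B S \<union> ?B (transpose S))"
    using S(1) T(1) by (intro card_mono) auto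
  also have "\<dots> \<le> card (?B S) + card (?B (transpose S))"
    by (rule card_Un_le)
  also have "\<dots> \<le> 4 * card (W - U)"
    using S(2) T(2) by linarith
  finally show ?thesis .
qed

text \<open>The closure conditions put all neighbours of \<open>P n\<close> into
  \<open>P (Suc n)\<close>, so the growth criterion applies with \<open>d = 4\<close>, two for each
  of the two matrices.\<close>

lemma cheeger_constant_GS_le_0:
  fixes P :: "nat \<Rightarrow> (int ^ 2) set"
  assumes "invertible S"
    and "\<And>n. 0 \<notin> P n" "\<And>n. finite (P n)" "P 0 \<noteq> {}" "\<And>n. P n \<subseteq> P (Suc n)"
    and "\<And>n z. z \<in> P n \<Longrightarrow> S *v z \<in> P (Suc n)" "\<And>n z. S *v z \<in> P n \<Longrightarrow> z \<in> P (Suc n)"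
    and "\<And>n z. z \<in> P n \<Longrightarrow> transpose S *v z \<in> P (Suc n)"
    and "\<And>n z. transpose S *v z \<in> P n \<Longrightarrow> z \<in> P (Suc n)"
    and growth: "\<And>n. card (P n) \<le> C * (n + 1)"
  shows "cheeger_constant GS_vertices (GS_edges S) \<le> 0"
proof (rule cheeger_constant_le_0_if_linear_growth)
  show "real (card (edge_boundary (GS_edges S) (P n))) \<le> 4 * real (card (P (Suc n) - P n))" for n
    using card_edge_boundary_GS_edges_le[of S "P (Suc n)" "P n"] assms by force
  show "real (card (P n)) \<le> real C * (real n + 1)" for n
    using growth[of n] by (metis of_nat_1 of_nat_add of_nat_le_iff of_nat_mult)
qed (use assms in \<open>auto simp: GS_vertices_def\<close>)

section \<open>Symmetric matrices and matrices of trace zero\<close>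

lemma cheeger_constant_GS_symmetric:
  assumes "invertible S" "transpose S = S"
  shows "cheeger_constant GS_vertices (GS_edges S) \<le> 0"
proof -
  obtain B where B: "S ** B = mat 1" "B ** S = mat 1"
    using assms by (auto simp: invertible_def)
  then have "invertible B" by (auto simp: invertible_def)
  have SB: "S *v (B *v z) = z" "B *v (S *v z) = z" for z
    using B by (simp_all add: matrix_vector_mul_assoc)
  \<comment> \<open>An orbit segment: exponents from \<open>-n\<close> to \<open>n\<close>, with
    \<open>B\<close> the inverse of \<open>S\<close>, starting at the all-ones vector
    \<open>1\<close>.\<close>
  define P where "P n = (\<lambda>k. ((*v) S ^^ k) 1) ` {..n} \<union> (\<lambda>k. ((*v) B ^^ k) 1) ` {..n}" for n
  have nz: "((*v) A ^^ k) 1 \<noteq> 0" if "invertible A" for A :: "int ^ 2 ^ 2" and k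
    using that by (induction k) (simp_all add: matrix_vector_mult_eq_0_iff_int)
  \<comment> \<open>The pair \<open>A\<close>, \<open>A'\<close> treats a step forwards and a step
    backwards along the orbit at once.\<close>
  have shift: "A *v z \<in> P (Suc n)"
    if "z \<in> P n" "A = S \<and> A' = B \<or> A = B \<and> A' = S" for n z A A'
  proof -
    have inv: "A *v (A' *v x) = x" for x
      using that(2) SB by auto
    have P: "P n = (\<lambda>k. ((*v) A ^^ k) 1) ` {..n} \<union> (\<lambda>k. ((*v) A' ^^ k) 1) ` {..n}" for n
      using that(2) by (auto simp: P_def)
    from that(1) consider k where "k \<le> n" "z = ((*v) A ^^ k) 1"
      | k where "k \<le> n" "z = ((*v) A' ^^ k) 1"
      unfolding P by auto
    then show ?thesis
    proof cases
      case 1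
      then have "A *v z = ((*v) A ^^ Suc k) 1" by simp
      with 1 show ?thesis unfolding P by blast
    next
      case 2
      show ?thesis
      proof (cases k)
        case 0
        with 2 have "A *v z = ((*v) A ^^ 1) 1" by simp
        then show ?thesis unfolding P by (metis UnI1 atMost_iff image_eqI le_add1 plus_1_eq_Suc)
      next
        case (Suc j)
        with 2 have "A *v z = ((*v) A' ^^ j) 1" "j \<le> Suc n" by (simp_all add: inv)
        then show ?thesis unfolding P by blast
      qed
    qed
  qed
  have S: "S *v z \<in> P (Suc n)" if "z \<in> P n" for n z
    using shift[OF that, of S B] by simp
  have S': "z \<in> P (Suc n)" if "S *v z \<in> P n" for n z
    using shift[OF that, of B S] by (simp add: SB)
  show ?thesis
  proof (rule cheeger_constant_GS_le_0[where P = P and C = 2])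
    show "0 \<notin> P n" for n
      unfolding P_def using nz[OF \<open>invertible S\<close>] nz[OF \<open>invertible B\<close>] by force
    have "card (P n) \<le> card {..n} + card {..n}" for n
      unfolding P_def by (intro order_trans[OF card_Un_le] add_mono card_image_le) auto
    then show "card (P n) \<le> 2 * (n + 1)" for n
      by (metis card_atMost mult_2 Suc_eq_plus1)
    show "P n \<subseteq> P (Suc n)" for n
      unfolding P_def by (intro Un_mono image_mono) auto
  qed (use assms S S' in \<open>auto simp: P_def\<close>)
qed

fun alternate :: "('a \<Rightarrow> 'a) \<Rightarrow> ('a \<Rightarrow> 'a) \<Rightarrow> nat \<Rightarrow> 'a \<Rightarrow> 'a" where
  "alternate f g 0 z = z"
| "alternate f g (Suc n) z = f (alternate g f n z)"

lemma cayley_hamilton_trace_0: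
  fixes A :: "'a::comm_ring_1 ^ 2 ^ 2"
  assumes "trace A = 0"
  shows "A *v (A *v z) = - (det A *s z)"
proof -
  have tr: "A $ 2 $ 2 = - A $ 1 $ 1"
    using assms by (simp add: trace_def sum_2 eq_neg_iff_add_eq_0 add.commute)
  show ?thesis
    unfolding vec_eq_iff_2 by (simp add: matrix_vector_mult_nth_2 det_2 tr algebra_simps)
qed

text \<open>Up to sign \<open>S\<close> and its transpose are involutions, so every word in them
  reduces to an alternating one. There are two of these for each positive length, hence linear
  growth.\<close>

lemma cheeger_constant_GS_trace_0:
  assumes "invertible S" "trace S = 0"
  shows "cheeger_constant GS_vertices (GS_edges S) \<le> 0"
proof -
  let ?T = "transpose S"
  have T: "invertible ?T" "trace ?T = 0"
    using assms invertible_transpose_int by (auto simp: trace_def transpose_def)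
  \<comment> \<open>The alternating word of length \<open>k\<close> with outermost letter
    \<open>A\<close>, applied to the all-ones vector.\<close>
  define w where "w A k = alternate ((*v) A) ((*v) (transpose A)) k (1 :: int ^ 2)"
    for A :: "int ^ 2 ^ 2" and k
  have w_0: "w A 0 = 1" and w_Suc: "w A (Suc k) = A *v w (transpose A) k" for A k
    by (simp_all add: w_def)
  have sq: "A *v (A *v z) = z \<or> A *v (A *v z) = - z" if "A = S \<or> A = ?T" for A z
  proof -
    have "invertible A" "trace A = 0" using that assms T by auto
    then have "A *v (A *v z) = - (det A *s z)" "det A = 1 \<or> det A = -1"
      using cayley_hamilton_trace_0 det_invertible_int by blast+
    then show ?thesis by (auto simp: vec_eq_iff)
  qed
  have nz: "w A k \<noteq> 0" if "A = S \<or> A = ?T" for A k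
    using that
  proof (induction k arbitrary: A)
    case (Suc k)
    then have "w (transpose A) k \<noteq> 0" by auto
    then show ?case
      using Suc.prems T assms by (auto simp: w_Suc matrix_vector_mult_eq_0_iff_int)
  qed (simp add: w_0)
  define Q where "Q n = w S ` {..n} \<union> w ?T ` {..n}" for n
  \<comment> \<open>Closing under negation absorbs the sign in \<open>sq\<close>.\<close>
  define P where "P n = Q n \<union> uminus ` Q n" for n
  have P_uminus: "- z \<in> P n \<longleftrightarrow> z \<in> P n" for z n
    unfolding P_def by (metis (no_types, opaque_lifting) UnCI UnE imageE imageI minus_minus)
  have Q_mono: "Q n \<subseteq> Q (Suc n)" for n
    unfolding Q_def by (intro Un_mono image_mono) auto
  \<comment> \<open>Applying \<open>A\<close> lengthens a word that begins with
    \<open>transpose A\<close> and cancels, up to sign, a leading \<open>A\<close>.\<close>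
  have Q: "A *v z \<in> P (Suc n)" if "z \<in> Q n" "A = S \<or> A = ?T" for n z A
  proof -
    have Qeq: "Q n = w A ` {..n} \<union> w (transpose A) ` {..n}" for n
      using that(2) by (auto simp: Q_def)
    from that(1) consider k where "k \<le> n" "z = w (transpose A) k"
      | k where "k \<le> n" "z = w A k"
      unfolding Qeq by auto
    then show ?thesis
    proof cases
      case 1
      then have "A *v z = w A (Suc k)" by (simp add: w_Suc)
      with 1 show ?thesis unfolding P_def Qeq by blast
    next
      case 2
      show ?thesis
      proof (cases k)
        case 0
        with 2 have "A *v z = w A (Suc 0)" by (simp add: w_Suc w_0)
        then have "A *v z \<in> Q (Suc n)" unfolding Qeq by blast
        then show ?thesis unfolding P_def by blast
      next
        case (Suc j)
        with 2 have "w (transpose A) j \<in> Q (Suc n)" unfolding Qeq by auto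
        moreover have "A *v z = w (transpose A) j \<or> A *v z = - w (transpose A) j"
          using sq[OF that(2)] 2 Suc by (auto simp: w_Suc)
        ultimately show ?thesis unfolding P_def by auto
      qed
    qed
  qed
  have A_uminus: "A *v (- z) = - (A *v z)" for A :: "int ^ 2 ^ 2" and z
    unfolding vec_eq_iff_2 by (simp add: matrix_vector_mult_nth_2)
  have fwd: "A *v z \<in> P (Suc n)" if "z \<in> P n" "A = S \<or> A = ?T" for n z A
  proof (cases "z \<in> Q n")
    case False
    then have "- z \<in> Q n" using that by (auto simp: P_def)
    from Q[OF this that(2)] show ?thesis
      by (simp add: A_uminus P_uminus)
  qed (use Q that in blast)
  have bwd: "z \<in> P (Suc n)" if "A *v z \<in> P n" "A = S \<or> A = ?T" for n z A
    using fwd[OF that] sq[OF that(2), of z] by (auto simp: P_uminus)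
  show ?thesis
  proof (rule cheeger_constant_GS_le_0[where P = P and C = 4])
    show "0 \<notin> P n" for n
      unfolding P_def Q_def using nz by force
    have "card (Q n) \<le> card {..n} + card {..n}" for n
      unfolding Q_def by (intro order_trans[OF card_Un_le] add_mono card_image_le) auto
    moreover have "card (P n) \<le> card (Q n) + card (Q n)" for n
      unfolding P_def by (intro order_trans[OF card_Un_le] add_mono card_image_le) (auto simp: Q_def)
    ultimately show "card (P n) \<le> 4 * (n + 1)" for n
      by (smt (verit) Suc_eq_plus1 add_mono card_atMost mult_2 numeral_Bit0_eq_double mult.assoc order_trans)
    show "P n \<subseteq> P (Suc n)" for n
      unfolding P_def using Q_mono by (intro Un_mono image_mono)
  qed (use assms fwd bwd in \<open>auto simp: P_def Q_def\<close>)
qed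

section \<open>Rayleigh quotients and their gains\<close>

definition sqnorm :: "int ^ 2 \<Rightarrow> real" where
  "sqnorm z = (z $ 1)\<^sup>2 + (z $ 2)\<^sup>2"

text \<open>The Rayleigh quotient of \<open>transpose A ** A\<close>; division by zero makes it 0 at
  \<open>z = 0\<close>.\<close>

definition rayleigh :: "int ^ 2 ^ 2 \<Rightarrow> int ^ 2 \<Rightarrow> real" where
  "rayleigh A z = sqnorm (A *v z) / sqnorm z"

definition cross :: "int ^ 2 \<Rightarrow> int ^ 2 \<Rightarrow> real" where
  "cross z w = z $ 1 * w $ 2 - z $ 2 * w $ 1"

text \<open>The squared Frobenius norm, which is also the trace of
  \<open>transpose A ** A\<close>.\<close>

definition frob :: "int ^ 2 ^ 2 \<Rightarrow> real" where
  "frob A = (A $ 1 $ 1)\<^sup>2 + (A $ 1 $ 2)\<^sup>2 + (A $ 2 $ 1)\<^sup>2 + (A $ 2 $ 2)\<^sup>2"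

lemma frob_transpose: "frob (transpose A) = frob A"
  by (simp add: frob_def transpose_def)

lemma sqnorm_pos: "z \<noteq> 0 \<Longrightarrow> sqnorm z > 0"
  by (auto simp: sqnorm_def vec_eq_iff_2 sum_power2_gt_zero_iff)

lemma sqnorm_nonneg: "sqnorm z \<ge> 0"
  by (simp add: sqnorm_def)

lemma frob_nonneg: "frob A \<ge> 0"
  by (simp add: frob_def)

lemma sqnorm_mult_le: "sqnorm (A *v z) \<le> frob A * sqnorm z"
proof -
  define a b c d x y :: real where v: "a = A $ 1 $ 1" "b = A $ 1 $ 2" "c = A $ 2 $ 1" "d = A $ 2 $ 2"
    "x = z $ 1" "y = z $ 2"
  have "frob A * sqnorm z - sqnorm (A *v z) = (a * y - b * x)\<^sup>2 + (c * y - d * x)\<^sup>2"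
    by (simp add: frob_def sqnorm_def matrix_vector_mult_nth_2 flip: v)
       (simp add: power2_eq_square algebra_simps)
  then show ?thesis
    by (smt (verit) zero_le_power2)
qed

lemma rayleigh_bounds: "0 \<le> rayleigh A z" "rayleigh A z \<le> frob A"
proof -
  show "0 \<le> rayleigh A z"
    by (simp add: rayleigh_def sqnorm_nonneg)
  show "rayleigh A z \<le> frob A"
  proof (cases "z = 0")
    case True
    then show ?thesis by (simp add: rayleigh_def sqnorm_def frob_nonneg)
  next
    case False
    with sqnorm_mult_le[of A z] show ?thesis
      by (simp add: rayleigh_def pos_divide_le_eq sqnorm_pos)
  qed
qed

text \<open>Let \<open>M = transpose A ** A\<close> have trace \<open>t\<close> and determinant
  \<open>e\<close>. Cayley-Hamilton gives \<open>M w = t w - e z\<close>; substituting this, the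
  numerator becomes \<open>t\<close> times \<open>|z|^2 |w|^2 - <z, w>^2\<close>, which is
  \<open>t\<close> times the squared cross product.\<close>

lemma rayleigh_gain:
  assumes "invertible A" "z \<noteq> 0"
  defines "w \<equiv> transpose A *v (A *v z)"
  shows "rayleigh A w - rayleigh A z = frob A * (cross z w)\<^sup>2 / (sqnorm z * sqnorm w)"
proof -
  have "w \<noteq> 0"
    unfolding w_def using assms invertible_transpose_int by (simp add: matrix_vector_mult_eq_0_iff_int)
  define a b c d x y :: real where v: "a = A $ 1 $ 1" "b = A $ 1 $ 2" "c = A $ 2 $ 1" "d = A $ 2 $ 2"
    "x = z $ 1" "y = z $ 2"
  \<comment> \<open>The entries of the symmetric matrix \<open>transpose A ** A\<close>.\<close>
  define p q r where w: "p = a\<^sup>2 + c\<^sup>2" "q = a * b + c * d" "r = b\<^sup>2 + d\<^sup>2"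
  define x' y' where xy: "x' = p * x + q * y" "y' = q * x + r * y"
  have w_nth: "w $ 1 = x'" "w $ 2 = y'"
    by (simp_all add: w_def matrix_vector_mult_nth_2 transpose_def xy w power2_eq_square algebra_simps flip: v)
  have A_sq: "sqnorm (A *v u) = p * (u $ 1)\<^sup>2 + 2 * q * u $ 1 * u $ 2 + r * (u $ 2)\<^sup>2" for u
    by (simp add: sqnorm_def matrix_vector_mult_nth_2 w power2_eq_square algebra_simps flip: v)
  have "sqnorm (A *v w) * sqnorm z - sqnorm (A *v z) * sqnorm w
      = (p * x'\<^sup>2 + 2 * q * x' * y' + r * y'\<^sup>2) * (x\<^sup>2 + y\<^sup>2)
        - (p * x\<^sup>2 + 2 * q * x * y + r * y\<^sup>2) * (x'\<^sup>2 + y'\<^sup>2)"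
    unfolding A_sq by (simp add: sqnorm_def w_nth flip: v)
  also have "\<dots> = (p + r) * (x * y' - y * x')\<^sup>2"
    unfolding xy by algebra
  also have "\<dots> = frob A * (cross z w)\<^sup>2"
    by (simp add: frob_def cross_def w_nth w flip: v)
  finally have "sqnorm (A *v w) * sqnorm z - sqnorm (A *v z) * sqnorm w = frob A * (cross z w)\<^sup>2" .
  with sqnorm_pos[OF \<open>w \<noteq> 0\<close>] sqnorm_pos[OF \<open>z \<noteq> 0\<close>] show ?thesis
    by (simp add: rayleigh_def field_simps)
qed

text \<open>Bounding \<open>sqnorm w\<close> by a multiple of \<open>sqnorm z\<close> leaves a
  denominator that depends on \<open>z\<close> only through \<open>sqnorm z\<close>.\<close>

lemma rayleigh_gain_ge:
  assumes "invertible A" "z \<noteq> 0"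
  defines "w \<equiv> transpose A *v (A *v z)"
  shows "rayleigh A w - rayleigh A z \<ge> (cross z w)\<^sup>2 / (frob A * (sqnorm z)\<^sup>2)"
proof -
  have nz: "A *v z \<noteq> 0" "w \<noteq> 0"
    unfolding w_def using assms invertible_transpose_int by (simp_all add: matrix_vector_mult_eq_0_iff_int)
  have z: "sqnorm z > 0" "sqnorm w > 0" "sqnorm (A *v z) > 0"
    using assms nz sqnorm_pos by auto
  have "frob A \<noteq> 0" using sqnorm_mult_le[of A z] z by auto
  then have frob: "frob A > 0" using frob_nonneg[of A] by simp
  have "sqnorm w \<le> frob A * sqnorm (A *v z)"
    unfolding w_def using sqnorm_mult_le[of "transpose A"] by (simp add: frob_transpose)
  also have "\<dots> \<le> frob A * (frob A * sqnorm z)"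
    using sqnorm_mult_le frob by (intro mult_left_mono) auto
  finally have w: "sqnorm w \<le> (frob A)\<^sup>2 * sqnorm z" by (simp add: power2_eq_square)
  have "(cross z w)\<^sup>2 / (frob A * (sqnorm z)\<^sup>2)
      = frob A * (cross z w)\<^sup>2 / (sqnorm z * ((frob A)\<^sup>2 * sqnorm z))"
    using frob z by (simp add: field_simps power2_eq_square)
  also have "\<dots> \<le> frob A * (cross z w)\<^sup>2 / (sqnorm z * sqnorm w)"
    using frob z w by (intro divide_left_mono mult_left_mono mult_pos_pos) auto
  finally show ?thesis
    using rayleigh_gain[OF assms(1,2)] by (simp add: w_def)
qed

text \<open>Both cross products are linear combinations of \<open>u = x^2 - y^2\<close> and
  \<open>v = x y\<close>, and \<open>|z|^4 = u^2 + 4 v^2\<close>. The coefficient matrix is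
  nonsingular, so \<open>u\<close> and \<open>v\<close> can be recovered from them.\<close>

lemma cross_forms_definite:
  fixes S :: "int ^ 2 ^ 2"
  assumes "invertible S" "S \<noteq> transpose S" "trace S \<noteq> 0"
  obtains K where "K > 0"
    "\<And>z. (sqnorm z)\<^sup>2 \<le> K * ((cross z (transpose S *v (S *v z)))\<^sup>2
                                + (cross z (S *v (transpose S *v z)))\<^sup>2)"
proof -
  define a b c d :: int where v: "a = S $ 1 $ 1" "b = S $ 1 $ 2" "c = S $ 2 $ 1" "d = S $ 2 $ 2"
  have bc: "b \<noteq> c"
    using assms(2) by (auto simp: vec_eq_iff_2 transpose_def v)
  have ad: "a + d \<noteq> 0"
    using assms(3) by (simp add: trace_def sum_2 v)
  have det: "a * d - b * c = 1 \<or> a * d - b * c = -1"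
    using det_invertible_int[OF assms(1)] by (simp add: det_2 v)
  \<comment> \<open>Otherwise \<open>S\<close> is a scaled rotation with both \<open>c\<close> and
    \<open>d\<close> nonzero, and its determinant is at least 2.\<close>
  have nn: "a \<noteq> d \<or> b \<noteq> - c"
  proof (rule ccontr)
    assume "\<not> ?thesis"
    then have eq: "a = d" "b = - c" by auto
    with det have "d\<^sup>2 + c\<^sup>2 = 1 \<or> d\<^sup>2 + c\<^sup>2 = -1" by (simp add: power2_eq_square)
    moreover have "d\<^sup>2 \<ge> 1" "c\<^sup>2 \<ge> 1"
      using ad bc eq by (auto simp: int_one_le_iff_zero_less)
    ultimately show False by linarith
  qed
  define q s q' s' :: int where w: "q = a * b + c * d" "s = b\<^sup>2 + d\<^sup>2 - a\<^sup>2 - c\<^sup>2"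
    "q' = a * c + b * d" "s' = c\<^sup>2 + d\<^sup>2 - a\<^sup>2 - b\<^sup>2"
  define D where "D = q' * s - q * s'"
  \<comment> \<open>\<open>D\<close> is the determinant expressing the two quadratic forms through \<open>x\<^sup>2 - y\<^sup>2\<close> and \<open>x y\<close>.\<close>
  have "D = (b - c) * (a + d) * ((a - d)\<^sup>2 + (b + c)\<^sup>2)"
    unfolding D_def w by algebra
  moreover have "(a - d)\<^sup>2 + (b + c)\<^sup>2 \<noteq> 0"
    using nn by (auto simp: sum_power2_eq_zero_iff)
  ultimately have "D \<noteq> 0" using bc ad by simp
  \<comment> \<open>Integrality bounds the determinant away from 0, so \<open>K\<close> needs no
    division by it.\<close>
  then have "1 \<le> D\<^sup>2"
    by (simp add: int_one_le_iff_zero_less)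
  define K :: real where "K = s\<^sup>2 + s'\<^sup>2 + 4 * q\<^sup>2 + 4 * q'\<^sup>2 + 1"
  show ?thesis
  proof
    show "K > 0" unfolding K_def by (simp add: add_nonneg_pos)
    fix z :: "int ^ 2"
    define u v :: int where uv: "u = (z $ 1)\<^sup>2 - (z $ 2)\<^sup>2" "v = z $ 1 * z $ 2"
    define X Y :: int where XY: "X = q * u + s * v" "Y = q' * u + s' * v"
    have X: "cross z (transpose S *v (S *v z)) = X"
      unfolding cross_def XY uv w
      by (simp add: matrix_vector_mult_nth_2 transpose_def flip: v)
         (simp add: power2_eq_square algebra_simps)
    have Y: "cross z (S *v (transpose S *v z)) = Y"
      unfolding cross_def XY uv w
      by (simp add: matrix_vector_mult_nth_2 transpose_def flip: v)
         (simp add: power2_eq_square algebra_simps)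
    have sq: "(sqnorm z)\<^sup>2 = real_of_int u ^ 2 + 4 * real_of_int v ^ 2"
      unfolding sqnorm_def uv by (simp add: power2_eq_square algebra_simps)
    \<comment> \<open>Cramer's rule; \<open>cs\<close> is then Cauchy-Schwarz.\<close>
    have Du: "D * u = s * Y - s' * X" and Dv: "D * v = q' * X - q * Y"
      unfolding D_def XY by (simp_all add: algebra_simps)
    have cs: "(\<alpha> * X - \<beta> * Y)\<^sup>2 \<le> (\<alpha>\<^sup>2 + \<beta>\<^sup>2) * (X\<^sup>2 + Y\<^sup>2)" for \<alpha> \<beta> :: int
    proof -
      have "(\<alpha>\<^sup>2 + \<beta>\<^sup>2) * (X\<^sup>2 + Y\<^sup>2) - (\<alpha> * X - \<beta> * Y)\<^sup>2 = (\<alpha> * Y + \<beta> * X)\<^sup>2"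
        by (simp add: power2_eq_square algebra_simps)
      then show ?thesis by (smt (verit) zero_le_power2)
    qed
    have "u\<^sup>2 + 4 * v\<^sup>2 \<le> D\<^sup>2 * (u\<^sup>2 + 4 * v\<^sup>2)"
      using \<open>1 \<le> D\<^sup>2\<close> mult_right_mono[of 1 "D\<^sup>2" "u\<^sup>2 + 4 * v\<^sup>2"] by simp
    also have "\<dots> = (D * u)\<^sup>2 + 4 * (D * v)\<^sup>2"
      by (simp add: power_mult_distrib algebra_simps)
    also have "\<dots> = (s' * X - s * Y)\<^sup>2 + 4 * (q' * X - q * Y)\<^sup>2"
      unfolding Du Dv by (simp add: power2_commute)
    also have "\<dots> \<le> (s'\<^sup>2 + s\<^sup>2) * (X\<^sup>2 + Y\<^sup>2) + 4 * ((q'\<^sup>2 + q\<^sup>2) * (X\<^sup>2 + Y\<^sup>2))"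
      using cs by (intro add_mono mult_left_mono) auto
    also have "\<dots> \<le> (s\<^sup>2 + s'\<^sup>2 + 4 * q\<^sup>2 + 4 * q'\<^sup>2 + 1) * (X\<^sup>2 + Y\<^sup>2)"
      by (simp add: algebra_simps)
    finally have "real_of_int (u\<^sup>2 + 4 * v\<^sup>2)
        \<le> real_of_int ((s\<^sup>2 + s'\<^sup>2 + 4 * q\<^sup>2 + 4 * q'\<^sup>2 + 1) * (X\<^sup>2 + Y\<^sup>2))"
      by (simp only: of_int_le_iff)
    then show "(sqnorm z)\<^sup>2 \<le> K * ((cross z (transpose S *v (S *v z)))\<^sup>2
                                + (cross z (S *v (transpose S *v z)))\<^sup>2)"
      unfolding X Y sq K_def by simp
  qed
qed

section \<open>Summation over a finite set and the lower bound\<close>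

lemma sum_gain_le:
  fixes f :: "'v \<Rightarrow> real"
  assumes "finite U" "inj g" "\<And>z. 0 \<le> f z" "\<And>z. f z \<le> M"
  shows "(\<Sum>z\<in>U. f (g z) - f z) \<le> M * card (g ` U - U)"
proof -
  have "(\<Sum>z\<in>U. f (g z)) = sum f (g ` U)"
    using assms(2) by (simp add: sum.reindex inj_on_subset[OF assms(2)])
  also have "\<dots> = sum f (g ` U - U) + sum f (g ` U \<inter> U)"
    using assms(1) by (metis add.commute finite_imageI sum.Int_Diff)
  also have "sum f (g ` U - U) \<le> of_nat (card (g ` U - U)) * M"
    using assms by (intro sum_bounded_above)
  also have "sum f (g ` U \<inter> U) \<le> sum f U"
    using assms by (intro sum_mono2) auto
  finally show ?thesis
    by (simp add: sum_subtractf mult.commute)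
qed

lemma card_comp_image_diff_le:
  assumes "finite U" "inj f"
  shows "card (f ` g ` U - U) \<le> card (g ` U - U) + card (f ` U - U)"
proof -
  have "card (f ` g ` U - U) \<le> card (f ` (g ` U - U) \<union> (f ` U - U))"
    using assms by (intro card_mono) auto
  also have "\<dots> \<le> card (f ` (g ` U - U)) + card (f ` U - U)"
    by (rule card_Un_le)
  also have "card (f ` (g ` U - U)) = card (g ` U - U)"
    using assms by (intro card_image) (auto intro: inj_on_subset)
  finally show ?thesis by simp
qed

text \<open>A point \<open>z\<close> of \<open>U\<close> with \<open>A *v z\<close> outside is the
  only endpoint in \<open>U\<close> of its edge, so distinct such points give distinct boundary
  edges.\<close>

lemma card_image_diff_le_edge_boundary:
  assumes "invertible S" "finite U" "U \<subseteq> GS_vertices" "A = S \<or> A = transpose S"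
  shows "card ((*v) A ` U - U) \<le> card (edge_boundary (GS_edges S) U)"
proof -
  let ?X = "{z \<in> U. A *v z \<notin> U}"
  have "card ((*v) A ` U - U) \<le> card ((*v) A ` ?X)"
    using assms(2) by (intro card_mono) auto
  also have "\<dots> \<le> card ?X"
    using assms(2) by (intro card_image_le) auto
  also have "card ?X = card ((\<lambda>z. {z, A *v z}) ` ?X)"
    by (intro card_image[symmetric] inj_onI) (auto simp: doubleton_eq_iff)
  also have "\<dots> \<le> card (edge_boundary (GS_edges S) U)"
    using finite_edge_boundary_GS_edges[OF assms(1,2)] assms(3,4)
    by (intro card_mono) (auto simp: edge_boundary_def GS_edges_def)
  finally show ?thesis .
qed

lemma cheeger_constant_GS_pos:
  fixes S :: "int ^ 2 ^ 2"
  assumes "invertible S" "S \<noteq> transpose S" "trace S \<noteq> 0"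
  shows "cheeger_constant GS_vertices (GS_edges S) > 0"
proof -
  let ?T = "transpose S"
  let ?g = "\<lambda>z. ?T *v (S *v z)" and ?h = "\<lambda>z. S *v (?T *v z)"
  define F where "F = frob S"
  obtain K where K: "K > 0"
    "\<And>z. (sqnorm z)\<^sup>2 \<le> K * ((cross z (?g z))\<^sup>2 + (cross z (?h z))\<^sup>2)"
    using cross_forms_definite[OF assms] by blast
  have T: "invertible ?T" using assms(1) by (rule invertible_transpose_int)
  have inj: "inj ((*v) S)" "inj ((*v) ?T)"
    using assms(1) T inj_matrix_vector_mult_int by blast+
  have inj_gh: "inj ?g" "inj ?h"
    using inj_compose[OF inj(2,1)] inj_compose[OF inj] by (simp_all add: o_def)
  have "F \<noteq> 0"
  proof
    assume "F = 0"
    then have "S $ 1 $ 2 = 0" "S $ 2 $ 1 = 0"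
      using sum_power2_ge_zero by (auto simp: F_def frob_def add_nonneg_eq_0_iff)
    then show False using assms(2) by (simp add: vec_eq_iff_2 transpose_def)
  qed
  then have F: "F > 0" using frob_nonneg[of S] by (simp add: F_def)
  have gain: "(rayleigh S (?g z) - rayleigh S z) + (rayleigh ?T (?h z) - rayleigh ?T z) \<ge> 1 / (F * K)"
    if "z \<noteq> 0" for z
  proof -
    have z: "sqnorm z > 0" using that by (rule sqnorm_pos)
    have "1 / (F * K) = (sqnorm z)\<^sup>2 / K / (F * (sqnorm z)\<^sup>2)"
      using z by simp
    also have "\<dots> \<le> ((cross z (?g z))\<^sup>2 + (cross z (?h z))\<^sup>2) / (F * (sqnorm z)\<^sup>2)"
      using K z F by (intro divide_right_mono) (auto simp: pos_divide_le_eq mult.commute)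
    also have "\<dots> \<le> (rayleigh S (?g z) - rayleigh S z) + (rayleigh ?T (?h z) - rayleigh ?T z)"
      using rayleigh_gain_ge[OF assms(1) that] rayleigh_gain_ge[OF T that]
      by (simp add: add_divide_distrib F_def frob_transpose)
    finally show ?thesis .
  qed
  \<comment> \<open>Each point gains at least \<open>1 / (F * K)\<close>. The maps \<open>?g\<close>
    and \<open>?h\<close> consist of two edge steps each, so each moves at most \<open>2 * B\<close>
    points out of \<open>U\<close>, at a cost of at most \<open>F\<close> per point: in total
    \<open>4 * F * B\<close>.\<close>
  have "1 / (4 * F\<^sup>2 * K) \<le> cheeger_constant GS_vertices (GS_edges S)"
  proof (rule cheeger_constant_ge)
    have "(1 :: int ^ 2) \<in> GS_vertices" by (simp add: GS_vertices_def)
    then show "GS_vertices \<noteq> {}" by blast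
    fix U assume U: "U \<subseteq> GS_vertices" "finite U" "U \<noteq> {}"
    define B where "B = card (edge_boundary (GS_edges S) U)"
    have SU: "card ((*v) S ` U - U) \<le> B" and TU: "card ((*v) ?T ` U - U) \<le> B"
      unfolding B_def using card_image_diff_le_edge_boundary[OF assms(1) U(2,1)] by auto
    have "card (?g ` U - U) \<le> 2 * B" "card (?h ` U - U) \<le> 2 * B"
      using card_comp_image_diff_le[OF U(2) inj(2), of "(*v) S"]
        card_comp_image_diff_le[OF U(2) inj(1), of "(*v) ?T"] SU TU
      by (simp_all add: image_image)
    then have B: "real (card (?g ` U - U)) \<le> 2 * B" "real (card (?h ` U - U)) \<le> 2 * B"
      by linarith+
    have "1 / (F * K) * card U
        = (\<Sum>z\<in>U. 1 / (F * K))" by simp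
    also have "\<dots> \<le> (\<Sum>z\<in>U. (rayleigh S (?g z) - rayleigh S z) + (rayleigh ?T (?h z) - rayleigh ?T z))"
      using U(1) by (intro sum_mono gain) (auto simp: GS_vertices_def)
    also have "\<dots> = (\<Sum>z\<in>U. rayleigh S (?g z) - rayleigh S z)
        + (\<Sum>z\<in>U. rayleigh ?T (?h z) - rayleigh ?T z)"
      by (rule sum.distrib)
    also have "\<dots> \<le> F * card (?g ` U - U) + F * card (?h ` U - U)"
      using inj_gh U(2) rayleigh_bounds[of S] rayleigh_bounds[of ?T]
      by (intro add_mono sum_gain_le) (simp_all add: F_def frob_transpose)
    also have "\<dots> \<le> F * (2 * B) + F * (2 * B)"
      using B F by (intro add_mono mult_left_mono) auto
    finally have "1 / (F * K) * card U \<le> 4 * F * B" by simp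
    then show "1 / (4 * F\<^sup>2 * K) * card U \<le> card (edge_boundary (GS_edges S) U)"
      unfolding B_def using F K(1) by (simp add: field_simps power2_eq_square)
  qed
  moreover have "1 / (4 * F\<^sup>2 * K) > 0" using F K(1) by simp
  ultimately show ?thesis by linarith
qed

theorem theorem4p1:
  fixes S :: "int ^ 2 ^ 2"
  assumes "invertible S"
  shows "cheeger_constant GS_vertices (GS_edges S) > 0 \<longleftrightarrow> S \<noteq> transpose S \<and> trace S \<noteq> 0"
  using cheeger_constant_GS_pos cheeger_constant_GS_symmetric cheeger_constant_GS_trace_0 assms
  by (metis not_le)

end
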